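(* Let $L$ be the line in $\mathbb{P}^2$ defined by $a_0x_0+a_1x_1+a_2x_2=0$, set $A=[a_0:a_1:a_2]\in\mathbb{P}^2$, and let $Q=[q_0:q_1:q_2]\in\mathbb{P}^2$ be any point. Then: (1) if $Q\notin\Delta_1$, then $Q\star L$ is the line defined by $\frac{a_0}{q_0}x_0+\frac{a_1}{q_1}x_1+\frac{a_2}{q_2}x_2=0$; (2) if $Q\in\Delta_1\setminus\Delta_0$ (so that $Q\in H_j$ for some $j\in\{0,1,2\}$), $A\in\Delta_i\setminus\Delta_{i-1}$ with $i\in\{0,1,2\}$, and $Q\star A\in\Delta_{i-1}$, then $Q\star L=H_j$; (3) if $Q\in\Delta_1\setminus\Delta_0$ (so that $Q\in H_j$ for some $j\in\{0,1,2\}$) and the hypotheses of (2) do not hold (that is, for the $i\in\{0,1,2\}$ with $A\in\Delta_i\setminus\Delta_{i-1}$ one has $Q\star A\notin\Delta_{i-1}$), then $Q\star L$ is the point of intersection of the line $H_j$ with the line defined by $a_kq_lx_k+a_lq_kx_l=0$, where $\{k,l\}=\{0,1,2\}\setminus\{j\}$; (4) if $Q\in\Delta_0$ and $Q\neq A$, then $Q\star L=Q$; (5) if $Q\in\Delta_0$ and $Q=A$, then $Q\star L$ is not defined (no product $Q\star P$ with $P\in L$ is defined).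
   Context: Work over an algebraically closed field $\mathbb{K}$; $\mathbb{P}^2$ is the projective plane with coordinates $x_0,x_1,x_2$. For points $P=[p_0:p_1:p_2]$, $Q=[q_0:q_1:q_2]$, the Hadamard product is $P\star Q=[p_0q_0:p_1q_1:p_2q_2]$, defined when not all $p_iq_i$ vanish. For a point $Q$ and a line $L$, $Q\star L$ is the Zariski closure of the set of all defined products $Q\star P$ with $P\in L$. $H_i$ is the line $x_i=0$. $\Delta_i$ is the set of points of $\mathbb{P}^2$ with at most $i+1$ nonzero coordinates ($\Delta_0$: the coordinate points; $\Delta_1$: the union of the coordinate lines; $\Delta_2=\mathbb{P}^2$). By convention $\Delta_{-1}=\{(0,0,0)\}$ contains no point of $\mathbb{P}^2$, and one writes $P\star Q\in\Delta_{-1}$ if $P\star Q$ is not defined (an undefined product is regarded as the zero vector). *)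

theory Defs
  imports
    "HOL-Analysis.Analysis"
    "HOL-Library.Poly_Mapping"
    "HOL-Computational_Algebra.Polynomial"
begin

text \<open>The index type \<^typ>\<open>3\<close> has exactly the elements \<open>0\<close>, \<open>1\<close>, \<open>2\<close>, so the coordinates
  of \<open>x :: 'k ^ 3\<close> are \<open>x $ 0\<close>, \<open>x $ 1\<close>, \<open>x $ 2\<close>.\<close>

definition proportional :: "'k::field ^ 3 \<Rightarrow> 'k ^ 3 \<Rightarrow> bool" where
  "proportional x y \<longleftrightarrow> x \<noteq> 0 \<and> y \<noteq> 0 \<and> (\<exists>c. y = c *s x)"

text \<open>\<open>proj x\<close> is the point \<open>[x $ 0 : x $ 1 : x $ 2]\<close>; it is meaningful only for \<open>x \<noteq> 0\<close>.
  \<open>coords P\<close> is an arbitrarily chosen vector of homogeneous coordinates of \<open>P\<close>.\<close>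

quotient_type (overloaded) 'k proj_plane = "'k::field ^ 3" / partial: proportional
  morphisms coords proj
proof (rule part_equivpI)
  show "\<exists>x::'k ^ 3. proportional x x"
    unfolding proportional_def
    by (rule exI[of _ 1]) (auto intro!: exI[of _ 1])
  show "symp (proportional :: 'k ^ 3 \<Rightarrow> _)"
  proof (rule sympI)
    fix x y :: "'k ^ 3"
    assume "proportional x y"
    then obtain c where c: "x \<noteq> 0" "y \<noteq> 0" "y = c *s x"
      unfolding proportional_def by blast
    then have "x = inverse c *s y"
      by (cases "c = 0") (auto simp: vector_smult_assoc)
    with c show "proportional y x"
      unfolding proportional_def by blast
  qed
  show "transp (proportional :: 'k ^ 3 \<Rightarrow> _)"
    by (rule transpI) (auto simp: proportional_def vector_smult_assoc)
qed

lemma proportional_nth_eq_0_iff: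
  "proportional x y \<Longrightarrow> x $ i = 0 \<longleftrightarrow> y $ i = 0"
  unfolding proportional_def by (metis mult_eq_0_iff vector_smult_component vector_smult_lzero)

text \<open>For \<open>b \<noteq> 0\<close> this is the line \<open>b $ 0 * x $ 0 + b $ 1 * x $ 1 + b $ 2 * x $ 2 = 0\<close>.\<close>

lift_definition on_line :: "'k::field ^ 3 \<Rightarrow> 'k proj_plane \<Rightarrow> bool" is
  "\<lambda>b x. (\<Sum>i\<in>UNIV. b $ i * x $ i) = 0"
proof -
  fix b x y :: "'k ^ 3"
  assume "proportional x y"
  then obtain c where "y \<noteq> 0" "y = c *s x"
    unfolding proportional_def by blast
  moreover have "(\<Sum>i\<in>UNIV. b $ i * (c *s x) $ i) = c * (\<Sum>i\<in>UNIV. b $ i * x $ i)"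
    by (simp add: sum_distrib_left mult_ac)
  ultimately show "((\<Sum>i\<in>UNIV. b $ i * x $ i) = 0) = ((\<Sum>i\<in>UNIV. b $ i * y $ i) = 0)"
    by auto
qed

definition line :: "'k::field ^ 3 \<Rightarrow> 'k proj_plane set" where
  "line b = {P. on_line b P}"

definition coord_line :: "3 \<Rightarrow> 'k::field proj_plane set" where
  "coord_line j = line (axis j 1)"

lift_definition num_nonzero :: "'k::field proj_plane \<Rightarrow> nat" is
  "\<lambda>x. card {i. x $ i \<noteq> 0}"
  by (simp add: proportional_nth_eq_0_iff)

text \<open>The index is an integer so that \<open>Delta (- 1)\<close> makes sense; as a set of points of the plane
  it is empty.\<close>

definition Delta :: "int \<Rightarrow> 'k::field proj_plane set" where
  "Delta i = {P. int (num_nonzero P) \<le> i + 1}"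

text \<open>The product of vectors is the componentwise one. \<open>None\<close> means that the product of the
  points is not defined.\<close>

lift_definition hadamard ::
  "'k::field proj_plane \<Rightarrow> 'k proj_plane \<Rightarrow> 'k proj_plane option" (infixl \<open>\<star>\<close> 70) is
  "\<lambda>x y. if x * y = 0 then None else Some (x * y)"
proof -
  fix x x' y y' :: "'k ^ 3"
  assume x: "proportional x x'" and y: "proportional y y'"
  then have iff: "x * y = 0 \<longleftrightarrow> x' * y' = 0"
    by (simp add: vec_eq_iff proportional_nth_eq_0_iff)
  from x y obtain c d where "x' = c *s x" "y' = d *s y"
    unfolding proportional_def by blast
  then have "x' * y' = (c * d) *s (x * y)"
    by (simp add: vec_eq_iff mult_ac)
  with iff show "rel_option proportional
      (if x * y = 0 then None else Some (x * y))
      (if x' * y' = 0 then None else Some (x' * y'))"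
    by (auto simp: proportional_def)
qed

text \<open>An undefined product is regarded as the zero vector, which has no nonzero coordinate and
  thus at most \<open>i + 1\<close> of them precisely when \<open>i \<ge> - 1\<close>.\<close>

definition hadamard_in_Delta :: "'k::field proj_plane \<Rightarrow> 'k proj_plane \<Rightarrow> int \<Rightarrow> bool" where
  "hadamard_in_Delta P Q i \<longleftrightarrow>
     (case P \<star> Q of None \<Rightarrow> - 1 \<le> i | Some R \<Rightarrow> R \<in> Delta i)"

text \<open>Polynomials in \<open>x\<^sub>0, x\<^sub>1, x\<^sub>2\<close>: finitely supported maps from exponent vectors to coefficients.\<close>

type_synonym 'k poly3 = "(3 \<Rightarrow>\<^sub>0 nat) \<Rightarrow>\<^sub>0 'k"

definition eval3 :: "'k::field poly3 \<Rightarrow> 'k ^ 3 \<Rightarrow> 'k" where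
  "eval3 p x = (\<Sum>m\<in>Poly_Mapping.keys p.
     Poly_Mapping.lookup p m * (\<Prod>i\<in>UNIV. x $ i ^ Poly_Mapping.lookup m i))"

definition homogeneous :: "'k::field poly3 \<Rightarrow> bool" where
  "homogeneous p \<longleftrightarrow>
     (\<exists>d. \<forall>m\<in>Poly_Mapping.keys p. (\<Sum>i\<in>UNIV. Poly_Mapping.lookup m i) = d)"

text \<open>Since the polynomials in \<open>F\<close> are homogeneous, their vanishing does not depend on the
  representatives chosen by \<open>coords\<close>.\<close>

definition zariski_closed :: "'k::field proj_plane set \<Rightarrow> bool" where
  "zariski_closed Z \<longleftrightarrow>
     (\<exists>F. (\<forall>p\<in>F. homogeneous p) \<and> Z = {P. \<forall>p\<in>F. eval3 p (coords P) = 0})"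

definition hadamard_set :: "'k::field proj_plane \<Rightarrow> 'k proj_plane set \<Rightarrow> 'k proj_plane set"
    (infixl \<open>\<star>\<star>\<close> 70) where
  "Q \<star>\<star> L = zariski_closed hull {R. \<exists>P\<in>L. Q \<star> P = Some R}"

end

theory Submission
  imports Defs
begin

text \<open>Choose coordinates \<open>q\<close> of \<open>Q\<close> and let \<open>L\<close> be the line \<open>a \<bullet> x = 0\<close>. A point with
  coordinates \<open>r\<close> is a product \<open>Q \<star> P\<close> with \<open>P \<in> L\<close> exactly when the equation \<open>q * p = r\<close> can be
  solved by a vector \<open>p\<close> with \<open>a \<bullet> p = 0\<close>. The coordinates \<open>p\<^sub>i = r\<^sub>i / q\<^sub>i\<close> with \<open>q\<^sub>i \<noteq> 0\<close> are forced,
  the coordinates with \<open>q\<^sub>i = 0\<close> are free but require \<open>r\<^sub>i = 0\<close>. If \<open>a\<close> has a nonzero coefficient at a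
  free coordinate, that coordinate can be used to satisfy \<open>a \<bullet> p = 0\<close>; otherwise the free coordinates
  do not enter that equation, which then says \<open>\<Sum> (a\<^sub>i / q\<^sub>i) r\<^sub>i = 0\<close>
  (lemma \<open>scaled_vector_in_plane_iff\<close>).

  Hence the set of products is cut out by linear equations: it is the intersection of the coordinate
  lines through \<open>Q\<close> with, possibly, the line with coefficients \<open>a\<^sub>i / q\<^sub>i\<close>. In particular it is
  Zariski closed already, so that taking the closure adds nothing (lemma \<open>hadamard_set_line\<close>). The
  first four cases of the theorem are read off from this description; in the fifth, the only coordinate
  that multiplication by \<open>q\<close> does not kill vanishes on \<open>L\<close>. The condition \<open>Q \<star> A \<in> \<Delta>\<^bsub>i-1\<^esub>\<close>
  in the second one says that \<open>Q \<star> A\<close> has fewer nonzero coordinates than \<open>A\<close>, which is to say that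
  \<open>a\<close> has a nonzero coefficient at a zero of \<open>q\<close> (lemma \<open>hadamard_drops_Delta_iff\<close>).\<close>

section \<open>Homogeneous coordinates\<close>

lemma proportional_refl: "x \<noteq> 0 \<Longrightarrow> proportional x x"
  unfolding proportional_def by (auto intro!: exI[of _ 1])

lemma proj_cases:
  obtains x where "x \<noteq> 0" "P = proj x"
proof
  show "coords P \<noteq> 0"
    using Quotient_rep_reflp[OF Quotient_proj_plane, of P] by (simp add: proportional_def)
  show "P = proj (coords P)"
    using Quotient_abs_rep[OF Quotient_proj_plane, of P] by simp
qed

lemma proj_eq_iff:
  assumes "x \<noteq> 0" "y \<noteq> 0"
  shows "proj x = proj y \<longleftrightarrow> (\<exists>c. y = c *s x)"
proof -
  have "proj x = proj y \<longleftrightarrow> proportional x y"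
    using Quotient_rel[OF Quotient_proj_plane, of x y] assms proportional_refl by blast
  then show ?thesis
    using assms by (simp add: proportional_def)
qed

lemma on_line_proj: "x \<noteq> 0 \<Longrightarrow> on_line b (proj x) \<longleftrightarrow> (\<Sum>i\<in>UNIV. b $ i * x $ i) = 0"
  by (simp add: on_line.abs_eq proportional_refl)

lemma proj_in_line: "x \<noteq> 0 \<Longrightarrow> proj x \<in> line b \<longleftrightarrow> (\<Sum>i\<in>UNIV. b $ i * x $ i) = 0"
  by (simp add: line_def on_line_proj)

lemma proj_in_coord_line:
  assumes "x \<noteq> 0"
  shows "proj x \<in> coord_line j \<longleftrightarrow> x $ j = 0"
proof -
  have "(\<Sum>i\<in>UNIV. axis j 1 $ i * x $ i) = (\<Sum>i\<in>UNIV. if i = j then x $ i else 0)"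
    by (rule sum.cong) (auto simp: axis_def)
  then show ?thesis
    using assms by (simp add: coord_line_def proj_in_line)
qed

lemma proj_in_Delta: "x \<noteq> 0 \<Longrightarrow> proj x \<in> Delta i \<longleftrightarrow> int (card {n. x $ n \<noteq> 0}) \<le> i + 1"
  by (simp add: Delta_def num_nonzero.abs_eq proportional_refl)

lemma hadamard_proj:
  "x \<noteq> 0 \<Longrightarrow> y \<noteq> 0 \<Longrightarrow> proj x \<star> proj y = (if x * y = 0 then None else Some (proj (x * y)))"
  by (simp add: hadamard.abs_eq proportional_refl)

lemma line_scale:
  fixes b :: "'k::field ^ 3"
  assumes "c \<noteq> 0"
  shows "line (c *s b) = line b"
proof (rule set_eqI)
  fix P :: "'k proj_plane"
  obtain x where x: "x \<noteq> 0" "P = proj x"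
    by (rule proj_cases)
  have "(\<Sum>i\<in>UNIV. (c *s b) $ i * x $ i) = c * (\<Sum>i\<in>UNIV. b $ i * x $ i)"
    by (simp add: sum_distrib_left mult_ac)
  then show "P \<in> line (c *s b) \<longleftrightarrow> P \<in> line b"
    using assms x by (simp add: proj_in_line)
qed

section \<open>Linear subspaces are Zariski closed\<close>

definition linear_form :: "'k::field ^ 3 \<Rightarrow> 'k poly3" where
  "linear_form b = (\<Sum>i\<in>UNIV. Poly_Mapping.single (Poly_Mapping.single i 1) (b $ i))"

lemma inj_single_one: "inj (\<lambda>i. Poly_Mapping.single i (1::nat))"
proof (rule injI)
  fix i j :: 'a
  assume "Poly_Mapping.single i (1::nat) = Poly_Mapping.single j 1"
  then have "Poly_Mapping.lookup (Poly_Mapping.single i (1::nat)) i =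
      Poly_Mapping.lookup (Poly_Mapping.single j 1) i"
    by simp
  then show "i = j"
    by (auto simp: lookup_single when_def split: if_splits)
qed

lemma keys_linear_form:
  "Poly_Mapping.keys (linear_form b) \<subseteq> range (\<lambda>i. Poly_Mapping.single i 1)"
  unfolding linear_form_def by (rule order.trans[OF keys_sum]) auto

lemma lookup_linear_form:
  "Poly_Mapping.lookup (linear_form b) (Poly_Mapping.single i 1) = b $ i"
proof -
  have "Poly_Mapping.lookup (linear_form b) (Poly_Mapping.single i 1) =
      (\<Sum>n\<in>UNIV. if n = i then b $ n else 0)"
    unfolding linear_form_def lookup_sum
    by (rule sum.cong) (auto simp: lookup_single when_def inj_eq[OF inj_single_one, unfolded One_nat_def])
  then show ?thesis
    by simp
qed

lemma homogeneous_linear_form: "homogeneous (linear_form b)"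
proof -
  have "(\<Sum>n\<in>UNIV. Poly_Mapping.lookup (Poly_Mapping.single i (1::nat)) n) = 1" for i :: 3
    by (simp add: lookup_single when_def)
  then show ?thesis
    unfolding homogeneous_def using keys_linear_form[of b] by (intro exI[of _ 1]) auto
qed

lemma eval3_linear_form: "eval3 (linear_form b) x = (\<Sum>i\<in>UNIV. b $ i * x $ i)"
proof -
  let ?s = "\<lambda>i::3. Poly_Mapping.single i (1::nat)"
  have monomial: "(\<Prod>n\<in>UNIV. x $ n ^ Poly_Mapping.lookup (?s i) n) = x $ i" for i
  proof -
    have "(\<Prod>n\<in>UNIV. x $ n ^ Poly_Mapping.lookup (?s i) n) =
        (\<Prod>n\<in>UNIV. if n = i then x $ n else 1)"
      by (rule prod.cong) (auto simp: lookup_single when_def)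
    then show ?thesis
      by simp
  qed
  have "eval3 (linear_form b) x =
      (\<Sum>m\<in>range ?s. Poly_Mapping.lookup (linear_form b) m *
         (\<Prod>n\<in>UNIV. x $ n ^ Poly_Mapping.lookup m n))"
    unfolding eval3_def using keys_linear_form[of b]
    by (intro sum.mono_neutral_left) (auto simp: in_keys_iff)
  also have "\<dots> = (\<Sum>i\<in>UNIV. b $ i * x $ i)"
    by (simp only: sum.reindex[OF inj_single_one] o_def lookup_linear_form monomial)
  finally show ?thesis .
qed

lemma zariski_closed_linear_subspace: "zariski_closed {P. \<forall>b\<in>B. on_line b P}"
  unfolding zariski_closed_def
  by (rule exI[of _ "linear_form ` B"])
    (auto simp: homogeneous_linear_form eval3_linear_form on_line.rep_eq)

section \<open>The product of a point and a line\<close>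

text \<open>A zero of \<open>q\<close> leaves the corresponding coordinate of \<open>p\<close> free; a nonzero coefficient of \<open>a\<close>
  there lets that coordinate repair the equation \<open>a \<bullet> p = 0\<close>. Otherwise the equation constrains only the
  forced coordinates \<open>r\<^sub>i / q\<^sub>i\<close>. Since \<open>x / 0 = 0\<close>, the sum on the right
  automatically runs over the nonzero coordinates of \<open>q\<close> only.\<close>

lemma scaled_vector_in_plane_iff:
  fixes a q r :: "'k::field ^ 'n"
  shows "(\<exists>p. (\<Sum>i\<in>UNIV. a $ i * p $ i) = 0 \<and> q * p = r) \<longleftrightarrow>
    (\<forall>i. q $ i = 0 \<longrightarrow> r $ i = 0) \<and>
    ((\<exists>i. q $ i = 0 \<and> a $ i \<noteq> 0) \<or> (\<Sum>i\<in>UNIV. a $ i / q $ i * r $ i) = 0)"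
    (is "?lhs \<longleftrightarrow> ?supp \<and> (?free \<or> ?sum)")
proof
  assume ?lhs
  then obtain p where p: "(\<Sum>i\<in>UNIV. a $ i * p $ i) = 0" "q * p = r"
    by blast
  have supp: ?supp
    using p(2) by auto
  have ?sum if "\<not> ?free"
  proof -
    have "(\<Sum>i\<in>UNIV. a $ i / q $ i * r $ i) = (\<Sum>i\<in>UNIV. a $ i * p $ i)"
      by (rule sum.cong) (use that p(2) in \<open>auto simp flip: p(2)\<close>)
    with p(1) show ?thesis
      by simp
  qed
  with supp show "?supp \<and> (?free \<or> ?sum)"
    by blast
next
  assume *: "?supp \<and> (?free \<or> ?sum)"
  let ?s = "\<Sum>i\<in>UNIV. a $ i / q $ i * r $ i"
  show ?lhs
  proof (cases ?free)
    case True
    then obtain n where n: "q $ n = 0" "a $ n \<noteq> 0"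
      by blast
    \<comment> \<open>The free coordinate \<open>n\<close> absorbs the value \<open>?s\<close> contributed by the forced ones.\<close>
    let ?p = "(\<chi> i. if i = n then - ?s / a $ n else r $ i / q $ i)"
    have "(\<Sum>i\<in>UNIV. a $ i * ?p $ i) =
        (\<Sum>i\<in>UNIV. a $ i / q $ i * r $ i + (if i = n then - ?s else 0))"
      by (rule sum.cong) (use n in auto)
    also have "\<dots> = 0"
      by (simp add: sum.distrib)
    finally have "(\<Sum>i\<in>UNIV. a $ i * ?p $ i) = 0" .
    moreover have "q * ?p = r"
      using * n by (auto simp: vec_eq_iff)
    ultimately show ?thesis
      by blast
  next
    case False
    with * show ?thesis
      by (intro exI[of _ "\<chi> i. r $ i / q $ i"]) (auto simp: vec_eq_iff)
  qed
qed

lemma hadamard_products_line: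
  assumes "q \<noteq> 0" "r \<noteq> 0"
  shows "(\<exists>P\<in>line a. proj q \<star> P = Some (proj r)) \<longleftrightarrow>
    (\<exists>p. (\<Sum>i\<in>UNIV. a $ i * p $ i) = 0 \<and> q * p = r)"
proof
  assume "\<exists>P\<in>line a. proj q \<star> P = Some (proj r)"
  then obtain P where P: "P \<in> line a" "proj q \<star> P = Some (proj r)"
    by blast
  obtain p where p: "p \<noteq> 0" "P = proj p"
    by (rule proj_cases)
  have qp: "q * p \<noteq> 0" "proj (q * p) = proj r"
    using P p assms by (auto simp: hadamard_proj split: if_splits)
  then obtain c where c: "r = c *s (q * p)"
    using proj_eq_iff[OF qp(1) assms(2)] by blast
  have "(\<Sum>i\<in>UNIV. a $ i * (c *s p) $ i) = c * (\<Sum>i\<in>UNIV. a $ i * p $ i)"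
    by (simp add: sum_distrib_left mult_ac)
  then have "(\<Sum>i\<in>UNIV. a $ i * (c *s p) $ i) = 0"
    using P p by (simp add: proj_in_line)
  moreover have "q * (c *s p) = r"
    using c by (simp add: vec_eq_iff mult_ac)
  ultimately show "\<exists>p. (\<Sum>i\<in>UNIV. a $ i * p $ i) = 0 \<and> q * p = r"
    by blast
next
  assume "\<exists>p. (\<Sum>i\<in>UNIV. a $ i * p $ i) = 0 \<and> q * p = r"
  then obtain p where p: "(\<Sum>i\<in>UNIV. a $ i * p $ i) = 0" "q * p = r"
    by blast
  then have "p \<noteq> 0"
    using assms by auto
  then show "\<exists>P\<in>line a. proj q \<star> P = Some (proj r)"
    using p assms by (intro bexI[of _ "proj p"]) (auto simp: hadamard_proj proj_in_line)
qed

text \<open>The linear equations describing the products show at the same time that the set of products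
  is closed, so the hull leaves it unchanged.\<close>

lemma hadamard_set_line:
  fixes a q :: "'k::field ^ 3"
  assumes "q \<noteq> 0"
  shows "proj q \<star>\<star> line a =
    (\<Inter>i\<in>{i. q $ i = 0}. coord_line i) \<inter>
    (if \<exists>i. q $ i = 0 \<and> a $ i \<noteq> 0 then UNIV else line (\<chi> i. a $ i / q $ i))"
    (is "_ = ?S")
proof -
  let ?B = "(\<lambda>i. axis i 1) ` {i. q $ i = 0} \<union>
    (if \<exists>i. q $ i = 0 \<and> a $ i \<noteq> 0 then {} else {\<chi> i. a $ i / q $ i})"
  have "?S = {P. \<forall>b\<in>?B. on_line b P}"
    by (auto simp: coord_line_def line_def)
  then have closed: "zariski_closed ?S"
    using zariski_closed_linear_subspace[of ?B] by simp
  have "{R. \<exists>P\<in>line a. proj q \<star> P = Some R} = ?S"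
  proof (rule set_eqI)
    fix R :: "'k proj_plane"
    obtain r where r: "r \<noteq> 0" "R = proj r"
      by (rule proj_cases)
    show "R \<in> {R. \<exists>P\<in>line a. proj q \<star> P = Some R} \<longleftrightarrow> R \<in> ?S"
      using hadamard_products_line[OF assms r(1), of a] r
      by (auto simp: scaled_vector_in_plane_iff proj_in_coord_line proj_in_line)
  qed
  with closed show ?thesis
    by (simp add: hadamard_set_def hull_same)
qed

text \<open>A line other than \<open>H\<^sub>j\<close> has a nonzero coefficient at some \<open>i \<noteq> j\<close>, and on \<open>H\<^sub>j\<close> its equation
  determines \<open>x\<^sub>i\<close> from the third coordinate.\<close>

lemma coord_line_Int_line:
  fixes b :: "'k::field ^ 3"
  assumes "i \<noteq> j" "b $ i \<noteq> 0"
  shows "\<exists>R. coord_line j \<inter> line b = {R}"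
proof -
  have "card (UNIV - {i, j}) = 1"
    using assms(1) by (simp add: card_Diff_subset)
  then obtain l where "UNIV - {i, j} = {l}"
    by (rule card_1_singletonE)
  then have l: "l \<noteq> i" "l \<noteq> j" "UNIV = {i, j, l}"
    by blast+
  have sum: "(\<Sum>n\<in>UNIV. b $ n * x $ n) = b $ i * x $ i + b $ j * x $ j + b $ l * x $ l"
    for x
    unfolding l(3) using l(1,2) assms(1) by (simp add: add_ac)
  let ?w = "axis l 1 + axis i (- b $ l / b $ i)"
  have w: "?w $ l = 1" "?w $ j = 0" "?w $ i = - b $ l / b $ i"
    using l assms(1) by (auto simp: axis_def)
  then have w0: "?w \<noteq> 0"
    by (metis zero_index zero_neq_one)
  have "P \<in> coord_line j \<inter> line b \<longleftrightarrow> P = proj ?w" for P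
  proof
    assume P: "P \<in> coord_line j \<inter> line b"
    obtain x where x: "x \<noteq> 0" "P = proj x"
      by (rule proj_cases)
    from P x have eqs: "x $ j = 0" "b $ i * x $ i + b $ l * x $ l = 0"
      by (auto simp: proj_in_coord_line proj_in_line sum)
    then have xi: "x $ i = x $ l * (- b $ l / b $ i)"
      using assms(2) by (simp add: field_simps eq_neg_iff_add_eq_0)
    have "x $ n = (x $ l *s ?w) $ n" for n
    proof -
      have "n \<in> {i, j, l}"
        using l(3) by blast
      then show ?thesis
        unfolding vector_smult_component using w eqs(1) xi by auto
    qed
    then have "x = x $ l *s ?w"
      unfolding vec_eq_iff by blast
    then show "P = proj ?w"
      using proj_eq_iff[OF w0 x(1)] x(2) by metis
  next
    assume "P = proj ?w"
    then show "P \<in> coord_line j \<inter> line b"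
      using w0 w assms(2)
      by (simp add: proj_in_coord_line proj_in_line sum del: vector_add_component)
  qed
  then show ?thesis
    by blast
qed

section \<open>Counting nonzero coordinates\<close>

lemma hadamard_in_Delta_proj:
  assumes "q \<noteq> 0" "a \<noteq> 0" "- 1 \<le> i"
  shows "hadamard_in_Delta (proj q) (proj a) i \<longleftrightarrow>
    int (card {n. q $ n \<noteq> 0 \<and> a $ n \<noteq> 0}) \<le> i + 1"
proof (cases "q * a = 0")
  case True
  then have "{n. q $ n \<noteq> 0 \<and> a $ n \<noteq> 0} = {}"
    by (auto simp: vec_eq_iff)
  then have card: "card {n. q $ n \<noteq> 0 \<and> a $ n \<noteq> 0} = 0"
    by (simp only: card.empty)
  show ?thesis
    unfolding hadamard_in_Delta_def card using True assms by (simp add: hadamard_proj)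
next
  case False
  with assms show ?thesis
    unfolding hadamard_in_Delta_def by (simp add: hadamard_proj proj_in_Delta)
qed

text \<open>\<open>A\<close> lies in \<open>\<Delta>\<^sub>i\<close> but not in \<open>\<Delta>\<^bsub>i-1\<^esub>\<close> when it has exactly \<open>i + 1\<close> nonzero coordinates. The
  nonzero coordinates of \<open>Q \<star> A\<close> are among these, so there are at most \<open>i\<close> of them precisely when
  one is lost, that is, multiplied by a zero of \<open>q\<close>.\<close>

lemma hadamard_drops_Delta_iff:
  fixes a q :: "'k::field ^ 3"
  assumes "a \<noteq> 0" "q \<noteq> 0"
  shows "(\<exists>i\<in>{0, 1, 2}. proj a \<in> Delta i - Delta (i - 1) \<and>
      hadamard_in_Delta (proj q) (proj a) (i - 1)) \<longleftrightarrow> (\<exists>n. q $ n = 0 \<and> a $ n \<noteq> 0)"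
proof -
  let ?a = "{n. a $ n \<noteq> 0}" and ?qa = "{n. q $ n \<noteq> 0 \<and> a $ n \<noteq> 0}"
  have "card ?a \<noteq> 0"
    using assms(1) by (auto simp: vec_eq_iff)
  moreover have "card ?a \<le> 3"
    using card_mono[of UNIV ?a] by simp
  ultimately have "card ?a = 1 \<or> card ?a = 2 \<or> card ?a = 3"
    by linarith
  then have range: "int (card ?a) - 1 \<in> {0, 1, 2}"
    by (elim disjE) simp_all
  have bex_eq_conj: "(\<exists>i\<in>I. i = c \<and> P i) \<longleftrightarrow> P c" if "c \<in> I" for I and c :: int and P
    using that by blast
  have exact: "proj a \<in> Delta i - Delta (i - 1) \<longleftrightarrow> i = int (card ?a) - 1" for i
    unfolding Diff_iff proj_in_Delta[OF assms(1)] by (rule iffI) simp_all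
  have "(\<exists>i\<in>{0, 1, 2}. proj a \<in> Delta i - Delta (i - 1) \<and>
      hadamard_in_Delta (proj q) (proj a) (i - 1)) \<longleftrightarrow>
      hadamard_in_Delta (proj q) (proj a) (int (card ?a) - 1 - 1)"
    unfolding exact by (rule bex_eq_conj[OF range])
  also have "\<dots> \<longleftrightarrow> card ?qa < card ?a"
  proof -
    have "- 1 \<le> int (card ?a) - 1 - 1"
      using range by auto
    from hadamard_in_Delta_proj[OF assms(2,1) this] show ?thesis
      by (simp only: diff_add_cancel) linarith
  qed
  also have "\<dots> \<longleftrightarrow> ?qa \<noteq> ?a"
  proof
    show "?qa \<noteq> ?a" if "card ?qa < card ?a"
      using that by (rule contrapos_pn) simp
    show "card ?qa < card ?a" if "?qa \<noteq> ?a"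
      using that by (intro psubset_card_mono psubsetI) auto
  qed
  also have "\<dots> \<longleftrightarrow> (\<exists>n. q $ n = 0 \<and> a $ n \<noteq> 0)"
    unfolding set_eq_iff mem_Collect_eq by blast
  finally show ?thesis .
qed

lemma proj_notin_Delta_1:
  fixes q :: "'k::field ^ 3"
  assumes "q \<noteq> 0" "proj q \<notin> Delta 1"
  shows "q $ n \<noteq> 0"
proof
  assume "q $ n = 0"
  then have "card {i. q $ i \<noteq> 0} \<le> card (UNIV - {n})"
    by (intro card_mono) auto
  with assms show False
    by (simp add: proj_in_Delta card_Diff_singleton)
qed

lemma proj_in_Delta_0E:
  fixes q :: "'k::field ^ 3"
  assumes "q \<noteq> 0" "proj q \<in> Delta 0"
  obtains j where "\<And>n. q $ n = 0 \<longleftrightarrow> n \<noteq> j"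
proof -
  have "card {n. q $ n \<noteq> 0} \<noteq> 0"
    using assms(1) by (auto simp: vec_eq_iff)
  moreover have "int (card {n. q $ n \<noteq> 0}) \<le> 1"
    using assms by (simp add: proj_in_Delta)
  ultimately have "card {n. q $ n \<noteq> 0} = 1"
    by linarith
  then obtain j where "{n. q $ n \<noteq> 0} = {j}"
    by (rule card_1_singletonE)
  with that show thesis
    by blast
qed

lemma proj_in_coord_line_notin_Delta_0:
  fixes q :: "'k::field ^ 3"
  assumes "q \<noteq> 0" "proj q \<in> coord_line j" "proj q \<notin> Delta 0"
  shows "q $ n = 0 \<longleftrightarrow> n = j"
proof
  show "q $ n = 0" if "n = j"
    using that assms by (simp add: proj_in_coord_line)
  show "n = j" if "q $ n = 0"
  proof (rule ccontr)
    assume "n \<noteq> j"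
    have "card {i. q $ i \<noteq> 0} \<le> card (UNIV - {n, j})"
      using that assms by (intro card_mono) (auto simp: proj_in_coord_line)
    also have "\<dots> = 1"
      using \<open>n \<noteq> j\<close> by (simp add: card_Diff_subset)
    finally show False
      using assms by (simp add: proj_in_Delta)
  qed
qed

section \<open>The five cases\<close>

theorem theorem3p4:
  fixes a q :: "'k::alg_closed_field ^ 3"
    and A Q :: "'k proj_plane"
    and L :: "'k proj_plane set"
  assumes "a \<noteq> 0" and "q \<noteq> 0"
    and "L = line a" and "A = proj a" and "Q = proj q"
  shows
    "(Q \<notin> Delta 1 \<longrightarrow> Q \<star>\<star> L = line (\<chi> i. a $ i / q $ i)) \<and>
     (\<forall>j. \<forall>i\<in>{0, 1, 2}.
        Q \<in> Delta 1 - Delta 0 \<and> Q \<in> coord_line j \<and>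
        A \<in> Delta i - Delta (i - 1) \<and> hadamard_in_Delta Q A (i - 1) \<longrightarrow>
        Q \<star>\<star> L = coord_line j) \<and>
     (\<forall>j k l.
        Q \<in> Delta 1 - Delta 0 \<and> Q \<in> coord_line j \<and>
        \<not> (\<exists>i\<in>{0, 1, 2}. A \<in> Delta i - Delta (i - 1) \<and> hadamard_in_Delta Q A (i - 1)) \<and>
        {k, l} = {0, 1, 2} - {j} \<longrightarrow>
        (\<exists>R. coord_line j \<inter> line (axis k (a $ k * q $ l) + axis l (a $ l * q $ k)) = {R} \<and>
             Q \<star>\<star> L = {R})) \<and>
     (Q \<in> Delta 0 \<and> Q \<noteq> A \<longrightarrow> Q \<star>\<star> L = {Q}) \<and>
     (Q \<in> Delta 0 \<and> Q = A \<longrightarrow> (\<forall>P\<in>L. Q \<star> P = None))"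
proof -
  have product: "Q \<star>\<star> L = (\<Inter>i\<in>{i. q $ i = 0}. coord_line i) \<inter>
      (if \<exists>i. q $ i = 0 \<and> a $ i \<noteq> 0 then UNIV else line (\<chi> i. a $ i / q $ i))"
    using assms by (simp add: hadamard_set_line)
  have drops: "(\<exists>i\<in>{0, 1, 2}. A \<in> Delta i - Delta (i - 1) \<and> hadamard_in_Delta Q A (i - 1)) \<longleftrightarrow>
      (\<exists>n. q $ n = 0 \<and> a $ n \<noteq> 0)"
    using assms hadamard_drops_Delta_iff by blast
  have zeros: "q $ n = 0 \<longleftrightarrow> n = j" if "Q \<in> Delta 1 - Delta 0" "Q \<in> coord_line j" for j n
    using that assms proj_in_coord_line_notin_Delta_0 by blast
  show ?thesis
  proof (intro conjI allI ballI impI)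
    assume "Q \<notin> Delta 1"
    then have "q $ n \<noteq> 0" for n
      using assms proj_notin_Delta_1 by blast
    then show "Q \<star>\<star> L = line (\<chi> i. a $ i / q $ i)"
      by (simp add: product)
  next
    fix j and i :: int
    assume "i \<in> {0, 1, 2}" and *: "Q \<in> Delta 1 - Delta 0 \<and> Q \<in> coord_line j \<and>
        A \<in> Delta i - Delta (i - 1) \<and> hadamard_in_Delta Q A (i - 1)"
    then have "\<exists>n. q $ n = 0 \<and> a $ n \<noteq> 0"
      using drops by blast
    moreover have "{n. q $ n = 0} = {j}"
      using * zeros by blast
    ultimately show "Q \<star>\<star> L = coord_line j"
      by (simp add: product)
  next
    fix j k l :: 3
    assume *: "Q \<in> Delta 1 - Delta 0 \<and> Q \<in> coord_line j \<and>
        \<not> (\<exists>i\<in>{0, 1, 2}. A \<in> Delta i - Delta (i - 1) \<and> hadamard_in_Delta Q A (i - 1)) \<and>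
        {k, l} = {0, 1, 2} - {j}"
    let ?b = "axis k (a $ k * q $ l) + axis l (a $ l * q $ k)"
    have q: "q $ n = 0 \<longleftrightarrow> n = j" for n
      using * zeros by blast
    have free: "\<not> (\<exists>n. q $ n = 0 \<and> a $ n \<noteq> 0)"
      using * drops by blast
    then have aj: "a $ j = 0"
      using q by blast
    have "{0, 1, 2} = (UNIV :: 3 set)"
      using UNIV_3 by auto
    then have kl: "{k, l} = UNIV - {j}"
      using * by simp
    then have "card {k, l} = 2"
      by (simp add: card_Diff_singleton)
    then have "k \<noteq> l"
      by auto
    have "k \<noteq> j" "l \<noteq> j"
      using kl by auto
    then have qkl: "q $ k \<noteq> 0" "q $ l \<noteq> 0"
      using q by auto
    \<comment> \<open>Clearing denominators turns the line with coefficients \<open>a\<^sub>i / q\<^sub>i\<close> into the stated one,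
      because \<open>a\<^sub>j = 0\<close>.\<close>
    have "?b $ n = ((q $ k * q $ l) *s (\<chi> i. a $ i / q $ i)) $ n" for n
    proof -
      have "n = j \<or> n = k \<or> n = l"
        using kl by blast
      then show ?thesis
        using qkl aj \<open>k \<noteq> l\<close> \<open>k \<noteq> j\<close> \<open>l \<noteq> j\<close> by (auto simp: axis_def)
    qed
    then have b: "?b = (q $ k * q $ l) *s (\<chi> i. a $ i / q $ i)"
      unfolding vec_eq_iff by blast
    have line_b: "line ?b = line (\<chi> i. a $ i / q $ i)"
      unfolding b using qkl by (intro line_scale) simp
    obtain i where i: "a $ i \<noteq> 0"
      using assms(1) by (auto simp: vec_eq_iff)
    then have "i \<noteq> j"
      using aj by auto
    then have "(\<chi> i. a $ i / q $ i) $ i \<noteq> 0"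
      using i q by simp
    then obtain R where R: "coord_line j \<inter> line (\<chi> i. a $ i / q $ i) = {R}"
      using coord_line_Int_line[OF \<open>i \<noteq> j\<close>] by blast
    have "{n. q $ n = 0} = {j}"
      using q by blast
    then have "Q \<star>\<star> L = coord_line j \<inter> line (\<chi> i. a $ i / q $ i)"
      using free by (simp add: product del: not_ex)
    then show "\<exists>R. coord_line j \<inter> line ?b = {R} \<and> Q \<star>\<star> L = {R}"
      using R line_b by auto
  next
    assume *: "Q \<in> Delta 0 \<and> Q \<noteq> A"
    then obtain j where j: "\<And>n. q $ n = 0 \<longleftrightarrow> n \<noteq> j"
      using assms proj_in_Delta_0E by blast
    have point: "proj x = Q" if "x \<noteq> 0" "\<And>n. n \<noteq> j \<Longrightarrow> x $ n = 0" for x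
    proof -
      have "x $ n = ((x $ j / q $ j) *s q) $ n" for n
        using that(2)[of n] j by (cases "n = j") auto
      then have "x = (x $ j / q $ j) *s q"
        unfolding vec_eq_iff by blast
      then show ?thesis
        using proj_eq_iff[OF assms(2) that(1)] assms(5) by metis
    qed
    \<comment> \<open>Otherwise \<open>A\<close> would be the coordinate point \<open>Q\<close>.\<close>
    have "\<exists>n. q $ n = 0 \<and> a $ n \<noteq> 0"
      using point[OF assms(1)] j * assms(4) by blast
    then have "Q \<star>\<star> L = (\<Inter>i\<in>{i. i \<noteq> j}. coord_line i)"
      by (simp add: product j)
    also have "\<dots> = {Q}"
    proof (rule set_eqI)
      fix P :: "'k proj_plane"
      obtain x where x: "x \<noteq> 0" "P = proj x"
        by (rule proj_cases)
      have "(\<forall>i. i \<noteq> j \<longrightarrow> Q \<in> coord_line i)"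
        using assms(2,5) j by (simp add: proj_in_coord_line)
      then show "P \<in> (\<Inter>i\<in>{i. i \<noteq> j}. coord_line i) \<longleftrightarrow> P \<in> {Q}"
        using point[OF x(1)] x by (auto simp: proj_in_coord_line)
    qed
    finally show "Q \<star>\<star> L = {Q}" .
  next
    fix P
    assume *: "Q \<in> Delta 0 \<and> Q = A" and P: "P \<in> L"
    then obtain j where j: "\<And>n. q $ n = 0 \<longleftrightarrow> n \<noteq> j"
      using assms proj_in_Delta_0E by blast
    obtain c where "a = c *s q"
      using * assms proj_eq_iff by metis
    then have a: "a $ n = 0 \<longleftrightarrow> n \<noteq> j" for n
      using j assms(1) by auto
    obtain p where p: "p \<noteq> 0" "P = proj p"
      by (rule proj_cases)
    have "(\<Sum>n\<in>UNIV. a $ n * p $ n) = (\<Sum>n\<in>UNIV. if n = j then a $ n * p $ n else 0)"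
      by (rule sum.cong) (auto simp: a)
    then have "a $ j * p $ j = 0"
      using P p assms(3) by (simp add: proj_in_line)
    then have "p $ j = 0"
      using a by simp
    then have "q * p = 0"
      using j by (auto simp: vec_eq_iff)
    then show "Q \<star> P = None"
      using assms(2,5) p by (simp add: hadamard_proj)
  qed
qed

end
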